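(* Let $\boldsymbol{q}=(q_n)_{n=1}^\infty=(1,2,1,3,1,2,1,4,\ldots)$ be the sequence where $q_n$ is the 2-adic valuation of $2n$, and let $\boldsymbol{p}=(p_n)_{n=1}^\infty=(1,1,2,3,5,7,\ldots)$, where $p_n$ is the number of partitions of the integer $n-1$. Then $\phi(\boldsymbol{q})=\boldsymbol{p}$, where $\phi$ is the map on integer sequences defined in the context.
   Context: For a sequence $\boldsymbol{a}=(a_n)_{n=1}^\infty$ of integers, $\phi(\boldsymbol{a})=\boldsymbol{u}$ is the sequence $(u_n)_{n=1}^\infty$ with ordinary generating function $\sum_{h=0}^\infty u_{h+1}t^h=\prod_{k=1}^\infty(1+t^k)^{a_k}$, as formal power series. *)

theory Defs
  imports
    "HOL-Library.Multiset"
    "HOL-Computational_Algebra.Computational_Algebra"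
    "HOL-Analysis.Analysis"
begin

text \<open>
  A sequence indexed from 1 is a function on \<^typ>\<open>nat\<close> whose value at 0 is irrelevant:
  \<open>\<phi>\<close> never reads it, and statements about sequences are restricted to indices \<open>n \<ge> 1\<close>.
\<close>

text \<open>
  Integer powers of a power series over the integers with constant coefficient 1. The library
  operators \<open>inverse\<close> and \<open>powi\<close> need an inverse on the coefficients, which \<^typ>\<open>int\<close> lacks;
  the second argument of \<open>fps_right_inverse\<close> is the inverse of the constant coefficient.
\<close>

definition fps_int_pow :: "int fps \<Rightarrow> int \<Rightarrow> int fps" where
  "fps_int_pow f m =
     (if m \<ge> 0 then f ^ nat m else fps_right_inverse f 1 ^ nat (- m))"

lemma fps_int_pow_minus:
  assumes "fps_nth f 0 = 1"
  shows "fps_int_pow f m * fps_int_pow f (- m) = 1"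
proof -
  have inv: "f * fps_right_inverse f 1 = 1"
    using assms by (intro fps_right_inverse) simp
  then have "f ^ n * fps_right_inverse f 1 ^ n = 1" for n
    by (simp flip: power_mult_distrib)
  then show ?thesis
    by (auto simp: fps_int_pow_def mult.commute)
qed

text \<open>
  The infinite product is taken in the usual (coefficientwise) topology on formal power
  series. The product index starts at 0 in \<open>prodinf\<close>, hence the shift.
\<close>

definition phi_factor :: "(nat \<Rightarrow> int) \<Rightarrow> nat \<Rightarrow> int fps" where
  "phi_factor a k = fps_int_pow (1 + fps_X ^ k) (a k)"

definition phi :: "(nat \<Rightarrow> int) \<Rightarrow> nat \<Rightarrow> int" where
  "phi a n = fps_nth (prodinf (\<lambda>k. phi_factor a (Suc k))) (n - 1)"

lemma phi_factor_dvd: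
  assumes "k > 0"
  shows "fps_X ^ k dvd phi_factor a k - 1"
proof -
  let ?f = "1 + fps_X ^ k :: int fps"
  let ?g = "fps_right_inverse ?f 1"
  have inv: "?f * ?g = 1"
    using assms by (intro fps_right_inverse) simp
  have "?g - 1 = fps_X ^ k * (- ?g)"
    using inv by (simp add: algebra_simps)
  then have g: "fps_X ^ k dvd ?g - 1"
    by (metis dvd_triv_left)
  have pow: "fps_X ^ k dvd h ^ n - 1" if "fps_X ^ k dvd h - 1" for h :: "int fps" and n
    using that by (simp add: power_diff_1_eq)
  show ?thesis
    using pow[OF g] pow[of ?f] by (auto simp: phi_factor_def fps_int_pow_def)
qed

lemma phi_has_prod:
  "(\<lambda>k. phi_factor a (Suc k)) has_prod (prodinf (\<lambda>k. phi_factor a (Suc k)))"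
proof -
  let ?f = "\<lambda>k. phi_factor a (Suc k)"
  define Q where "Q = Abs_fps (\<lambda>n. fps_nth (\<Prod>k\<le>n. ?f k) n)"
  have stab: "fps_nth (\<Prod>k\<le>Suc N. ?f k) n = fps_nth (\<Prod>k\<le>N. ?f k) n" if "n \<le> N" for n N
  proof -
    obtain h where h: "?f (Suc N) - 1 = fps_X ^ Suc (Suc N) * h"
      using phi_factor_dvd[of "Suc (Suc N)" a] by (auto elim: dvdE)
    have "(\<Prod>k\<le>Suc N. ?f k) = (\<Prod>k\<le>N. ?f k) + (\<Prod>k\<le>N. ?f k) * (?f (Suc N) - 1)"
      by (simp add: algebra_simps)
    also have "\<dots> = (\<Prod>k\<le>N. ?f k) + fps_X ^ Suc (Suc N) * (h * (\<Prod>k\<le>N. ?f k))"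
      by (simp only: h ac_simps)
    finally show ?thesis
      using that by (simp only: fps_add_nth fps_X_power_mult_nth) simp
  qed
  have const: "fps_nth (\<Prod>k\<le>N. ?f k) n = fps_nth Q n" if "n \<le> N" for n N
    using that
  proof (induction N rule: dec_induct)
    case base
    show ?case by (simp add: Q_def)
  next
    case (step N)
    then show ?case using stab[of n N] by simp
  qed
  have lim: "(\<lambda>N. \<Prod>k\<le>N. ?f k) \<longlonglongrightarrow> Q"
    by (rule tendsto_fpsI, rule eventually_sequentiallyI, rule const)
  have "fps_X dvd ?f 0 - 1"
    using phi_factor_dvd[of 1 a] by simp
  then have "fps_nth Q 0 = 1"
    by (auto simp: Q_def elim!: dvdE) (metis fps_X_mult_nth diff_eq_eq fps_add_nth fps_one_nth add_0)
  then have "Q \<noteq> 0" by auto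
  with lim have "?f has_prod Q"
    by (simp add: has_prod_def raw_has_prod_def)
  then show ?thesis
    by (metis has_prod_unique)
qed

definition seq_q :: "nat \<Rightarrow> int" where
  "seq_q n = int (multiplicity (2::nat) (2 * n))"

text \<open>A partition of \<open>n\<close> is a multiset of positive integers with sum \<open>n\<close>.\<close>

definition partitions :: "nat \<Rightarrow> nat multiset set" where
  "partitions n = {M. (\<forall>i\<in>#M. i > 0) \<and> sum_mset M = n}"

definition seq_p :: "nat \<Rightarrow> int" where
  "seq_p n = int (card (partitions (n - 1)))"

lemma finite_partitions: "finite (partitions n)"
proof (rule finite_subset)
  show "partitions n \<subseteq> (\<Union>m\<le>n. multisets_of_size {..n} m)"
  proof
    fix M assume "M \<in> partitions n"
    then have M: "\<forall>i\<in>#M. i > 0" "sum_mset M = n" by (auto simp: partitions_def)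
    have "size M \<le> sum_mset M"
      using M(1) by (induction M) auto
    moreover have "i \<le> n" if "i \<in># M" for i
      using that M(2) by (metis le_add1 multi_member_split sum_mset.add_mset)
    ultimately show "M \<in> (\<Union>m\<le>n. multisets_of_size {..n} m)"
      using M(2) by (auto simp: multisets_of_size_def)
  qed
qed (auto intro: finite_multisets_of_size)

end

theory Submission
  imports Defs
begin

text \<open>
  Write \<open>\<nu>\<close> for the 2-adic valuation and multiply the product of the factors
  \<open>1 + x^k\<close> (\<open>k \<le> N\<close>), each raised to the power \<open>\<nu>(2k)\<close>, by the product of all \<open>1 - x^k\<close>.
  Since \<open>(1 - x^k) (1 + x^k) = 1 - x^(2k)\<close>, factors telescope along the orbits of doubling;
  what remains is the product of the factors \<open>1 - x^k\<close> (\<open>N < k \<le> 2N\<close>), each raised to the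
  power \<open>\<nu>(k)\<close>, which is 1 modulo \<open>x^(N+1)\<close>. On the other side, the product of all \<open>1 - x^k\<close>
  is inverse to the generating function of partitions with parts at most \<open>N\<close>.
\<close>

lemma prod_one_plus_power_multiplicity:
  fixes x :: "'a::comm_ring_1"
  shows "(\<Prod>k=1..N. (1 + x ^ k) ^ multiplicity (2::nat) (2 * k)) * (\<Prod>k=1..N. 1 - x ^ k)
    = (\<Prod>k\<in>{N<..2*N}. (1 - x ^ k) ^ multiplicity 2 k)"
proof (induction N)
  case 0
  show ?case by simp
next
  case (Suc N)
  define f where "f k = (1 - x ^ k) ^ multiplicity (2::nat) k" for k
  \<comment> \<open>\<open>R\<close> is the part common to the old and the new range of indices. The
    step to \<open>Suc N\<close> drops the index \<open>Suc N\<close> and gains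
    \<open>2*N+1\<close>, which is odd and so has exponent 0, and \<open>2*N+2\<close>.\<close>
  define R where "R = prod f {Suc N<..2*N}"
  define y where "y = x ^ Suc N"
  define q where "q = multiplicity (2::nat) (Suc N)"
  have double: "multiplicity (2::nat) (2 * Suc N) = Suc q"
    unfolding q_def by (rule multiplicity_times_same) simp_all
  have "\<not> 2 dvd Suc (2 * N)"
    by simp
  then have f_odd: "f (Suc (2 * N)) = 1"
    by (simp add: f_def not_dvd_imp_multiplicity_0 del: even_Suc)
  have "x ^ (2 * Suc N) = y ^ 2"
    by (simp only: y_def power_mult [symmetric] mult.commute)
  then have f_even: "f (2 * Suc N) = (1 - y ^ 2) ^ Suc q"
    by (simp only: f_def double)
  have "{Suc N<..2 * Suc N} = insert (2 * Suc N) (insert (Suc (2 * N)) {Suc N<..2*N})"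
    if "N > 0" using that by auto
  \<comment> \<open>For \<open>N = 0\<close> the index \<open>2*N+1\<close> lies outside the new
    range, but its factor is 1 anyway.\<close>
  then have "prod f {Suc N<..2 * Suc N} = f (2 * Suc N) * (f (Suc (2 * N)) * R)"
  proof (cases "N = 0")
    case True
    have "{Suc 0<..2} = {2::nat}" by auto
    with True show ?thesis
      by (simp add: R_def f_def not_dvd_imp_multiplicity_0)
  qed (simp add: R_def)
  then have new: "prod f {Suc N<..2 * Suc N} = (1 - y ^ 2) ^ Suc q * R"
    by (simp only: f_odd f_even mult_1_left)
  have "prod f {N<..2*N} = (1 - y) ^ q * R"
  proof (cases "N = 0")
    case True
    then show ?thesis
      by (simp add: R_def q_def)
  next
    case False
    then have "{N<..2*N} = insert (Suc N) {Suc N<..2*N}" by auto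
    then show ?thesis
      by (simp add: R_def f_def y_def q_def del: power_Suc)
  qed
  with Suc.IH have IH: "(\<Prod>k=1..N. (1 + x ^ k) ^ multiplicity (2::nat) (2 * k)) * (\<Prod>k=1..N. 1 - x ^ k)
      = (1 - y) ^ q * R"
    by (simp add: f_def)
  have split: "(\<Prod>k=1..Suc N. g k) = (\<Prod>k=1..N. g k) * g (Suc N)" for g :: "nat \<Rightarrow> 'a"
    by simp
  have "(\<Prod>k=1..Suc N. (1 + x ^ k) ^ multiplicity (2::nat) (2 * k)) * (\<Prod>k=1..Suc N. 1 - x ^ k)
      = ((1 - y) ^ q * R) * ((1 + y) ^ Suc q * (1 - y))"
    unfolding split double IH[symmetric] y_def[symmetric]
    by (simp only: ac_simps)
  \<comment> \<open>The new factor \<open>1 - y\<close> lifts \<open>(1 - y) ^ q\<close> to the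
    exponent \<open>Suc q\<close> of \<open>1 + y\<close>, so the two powers merge.\<close>
  also have "\<dots> = ((1 - y) * (1 + y)) ^ Suc q * R"
    unfolding power_mult_distrib by (simp add: ac_simps)
  also have "(1 - y) * (1 + y) = 1 - y ^ 2"
    by (simp add: algebra_simps power2_eq_square)
  finally show ?case
    by (simp only: new [unfolded f_def])
qed

definition partitions_upto :: "nat \<Rightarrow> nat \<Rightarrow> nat multiset set" where
  "partitions_upto N n = {M \<in> partitions n. \<forall>i\<in>#M. i \<le> N}"

definition partitions_upto_fps :: "nat \<Rightarrow> 'a::comm_ring_1 fps" where
  "partitions_upto_fps N = Abs_fps (\<lambda>n. of_nat (card (partitions_upto N n)))"

lemma finite_partitions_upto: "finite (partitions_upto N n)"
  by (rule finite_subset[OF _ finite_partitions]) (auto simp: partitions_upto_def)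

text \<open>No part exceeds the sum, so the bound on the parts is vacuous here.\<close>

lemma partitions_upto_eq_partitions:
  assumes "n \<le> N"
  shows "partitions_upto N n = partitions n"
proof -
  have "i \<le> sum_mset M" if "i \<in># M" for i and M :: "nat multiset"
    using that by (metis le_add1 multi_member_split sum_mset.add_mset)
  with assms show ?thesis
    by (fastforce simp: partitions_upto_def partitions_def)
qed

text \<open>Split by whether \<open>Suc N\<close> occurs as a part. Removing one copy may leave
  others, so the bound stays \<open>Suc N\<close> on the right. The guard prevents truncated
  subtraction from adding a spurious partition.\<close>

lemma partitions_upto_Suc:
  "partitions_upto (Suc N) n = partitions_upto N n \<union>
     (if Suc N \<le> n then add_mset (Suc N) ` partitions_upto (Suc N) (n - Suc N) else {})"
  (is "?L = ?A \<union> ?B")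
proof (intro equalityI subsetI)
  fix M assume M: "M \<in> ?L"
  show "M \<in> ?A \<union> ?B"
  proof (cases "Suc N \<in># M")
    case True
    then obtain M' where M': "M = add_mset (Suc N) M'"
      by (meson multi_member_split)
    with M show ?thesis
      by (auto simp: partitions_upto_def partitions_def)
  next
    case False
    with M show ?thesis
      by (auto simp: partitions_upto_def le_Suc_eq)
  qed
next
  fix M assume "M \<in> ?A \<union> ?B"
  then show "M \<in> ?L"
    by (auto simp: partitions_upto_def partitions_def split: if_splits)
qed

lemma card_partitions_upto_Suc:
  "card (partitions_upto (Suc N) n) = card (partitions_upto N n) +
     (if Suc N \<le> n then card (partitions_upto (Suc N) (n - Suc N)) else 0)"
proof -
  have "M \<notin> partitions_upto N n" if "M \<in> range (add_mset (Suc N))" for M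
    using that by (auto simp: partitions_upto_def)
  then show ?thesis
    by (subst partitions_upto_Suc)
       (auto simp: card_image inj_on_def finite_partitions_upto intro!: card_Un_disjoint[THEN trans])
qed

text \<open>Coefficientwise, the recursion for the cardinalities says that multiplying by
  \<open>1 - fps_X ^ Suc N\<close> takes the series for \<open>Suc N\<close> to the one for
  \<open>N\<close>. Iterating leads down to the series for 0, which is 1 because only the empty
  partition remains.\<close>

lemma partitions_upto_fps_mult:
  "(\<Prod>k=1..N. 1 - fps_X ^ k) * partitions_upto_fps N = (1 :: 'a::comm_ring_1 fps)"
proof (induction N)
  case 0
  have "M \<in> partitions_upto 0 n \<longleftrightarrow> M = {#} \<and> n = 0" for M n
    by (cases M) (auto simp: partitions_upto_def partitions_def)
  then have "partitions_upto 0 n = (if n = 0 then {{#}} else {})" for n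
    by auto
  then show ?case
    by (simp add: partitions_upto_fps_def fps_eq_iff)
next
  case (Suc N)
  have "(1 - fps_X ^ Suc N) * partitions_upto_fps (Suc N) = (partitions_upto_fps N :: 'a fps)"
    unfolding left_diff_distrib fps_eq_iff fps_sub_nth mult_1_left fps_X_power_mult_nth
      partitions_upto_fps_def
    by (auto simp: card_partitions_upto_Suc[of N])
  with Suc show ?case
    by (simp add: mult.assoc del: power_Suc)
qed

text \<open>Being congruent to 1 modulo \<open>d\<close> is preserved by multiplication; over an
  infinite \<open>A\<close> the product is 1 by convention.\<close>

lemma dvd_prod_minus_one:
  fixes d :: "'a::comm_ring_1"
  assumes "\<And>i. i \<in> A \<Longrightarrow> d dvd f i - 1"
  shows "d dvd prod f A - 1"
  using assms
proof (induction A rule: infinite_finite_induct)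
  case (insert i A)
  have "prod f (insert i A) - 1 = f i * (prod f A - 1) + (f i - 1)"
    using insert.hyps by (simp add: algebra_simps)
  then show ?case
    using insert by (metis dvd_add dvd_mult insertCI)
qed auto

lemma dvd_power_minus_one:
  fixes d :: "'a::comm_ring_1"
  assumes "d dvd z - 1"
  shows "d dvd z ^ n - 1"
  using assms by (simp add: power_diff_1_eq)

text \<open>Convergence of power series is coefficientwise and integer coefficients are discrete, so
  each coefficient of the partial products is eventually constant. This replaces the infinite
  product by a finite one of length beyond any given \<open>m\<close>.\<close>

lemma phi_eq_nth_prod:
  obtains N where "N \<ge> m" and "phi a n = fps_nth (\<Prod>k=1..N. phi_factor a k) (n - 1)"
proof -
  have "(\<lambda>N. \<Prod>k<N. phi_factor a (Suc k)) \<longlonglongrightarrow> prodinf (\<lambda>k. phi_factor a (Suc k))"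
    by (rule has_prod_imp_tendsto'[OF phi_has_prod])
  then have "\<forall>\<^sub>F N in sequentially. fps_nth (\<Prod>k<N. phi_factor a (Suc k)) (n - 1) = phi a n"
    by (simp add: tendsto_fps_iff phi_def)
  then obtain N where "N \<ge> m" "fps_nth (\<Prod>k<N. phi_factor a (Suc k)) (n - 1) = phi a n"
    by (metis (mono_tags, lifting) eventually_sequentially max.cobounded1 max.cobounded2)
  then show ?thesis
    using that by (simp add: prod.atLeast1_atMost_eq)
qed

theorem proposition4:
  shows "\<forall>n\<ge>1. phi seq_q n = seq_p n"
proof (intro allI impI)
  fix n :: nat assume "n \<ge> 1"
  obtain N where N: "N \<ge> n"
    and phi: "phi seq_q n = fps_nth (\<Prod>k=1..N. phi_factor seq_q k) (n - 1)"
    by (rule phi_eq_nth_prod)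
  let ?F = "\<Prod>k=1..N. (1 + fps_X ^ k) ^ multiplicity (2::nat) (2 * k) :: int fps"
  let ?E = "\<Prod>k=1..N. 1 - fps_X ^ k :: int fps"
  let ?P = "partitions_upto_fps N :: int fps"
  have "fps_X ^ N dvd (1 - fps_X ^ k) ^ multiplicity (2::nat) k - (1 :: int fps)"
    if "k \<in> {N<..2*N}" for k
    using that by (intro dvd_power_minus_one) (auto intro: le_imp_power_dvd)
  then have "fps_X ^ N dvd ?F * ?E - 1"
    unfolding prod_one_plus_power_multiplicity by (rule dvd_prod_minus_one)
  then obtain h where h: "?F * ?E - 1 = fps_X ^ N * h" ..
  \<comment> \<open>Since \<open>?P\<close> is inverse to \<open>?E\<close>, the congruence of
    \<open>?F * ?E\<close> to 1 becomes one of \<open>?F\<close> to \<open>?P\<close>, modulo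
    \<open>fps_X ^ N\<close>.\<close>
  have "?F = ?F * (?E * ?P)"
    unfolding partitions_upto_fps_mult by simp
  also have "\<dots> = ?P + (?F * ?E - 1) * ?P"
    by (simp add: algebra_simps)
  also have "\<dots> = ?P + fps_X ^ N * (h * ?P)"
    by (simp only: h mult.assoc)
  \<comment> \<open>From \<open>1 \<le> n\<close> and \<open>n \<le> N\<close> follows
    \<open>n - 1 < N\<close>, so the multiple of \<open>fps_X ^ N\<close> does not reach this
    coefficient.\<close>
  finally have "fps_nth ?F (n - 1) = fps_nth ?P (n - 1)"
    using N \<open>n \<ge> 1\<close> by (simp only: fps_add_nth fps_X_power_mult_nth) simp
  \<comment> \<open>Valuations are nonnegative, so \<open>fps_int_pow\<close> is an ordinary power
    here.\<close>
  moreover have "phi_factor seq_q k = (1 + fps_X ^ k) ^ multiplicity (2::nat) (2 * k)" for k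
    by (simp add: phi_factor_def fps_int_pow_def seq_q_def)
  ultimately show "phi seq_q n = seq_p n"
    using N by (simp add: phi seq_p_def partitions_upto_fps_def partitions_upto_eq_partitions)
qed

end
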